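(* Let $G$ be a graph on $n \ge 2$ vertices with Seidel matrix $S(G)$. Then, for every real number $p>2$, $$\mathcal{E}_p(S(G)) \ge n\,(n-1)^{\frac{p}{2}},$$ with equality if and only if $S(G)^2=(n-1)I$, that is, if and only if $S(G)$ is a symmetric conference matrix.
   Context: All graphs are finite, simple, undirected, non-empty and have at least one edge. For a graph $G$ with vertex set $\{v_1,\dots,v_n\}$, the Seidel matrix $S(G)$ is the real symmetric $n\times n$ matrix with zero diagonal whose $(i,j)$-entry, for $i\neq j$, is $-1$ if $v_i$ and $v_j$ are adjacent and $+1$ otherwise. If $\lambda_1,\dots,\lambda_n$ are the eigenvalues of $S(G)$ (with multiplicity), the $p$-Seidel energy is $\mathcal{E}_p(S(G))=\sum_{i=1}^n|\lambda_i|^p$ for $p>0$. A conference matrix of order $n$ is an $n\times n$ matrix $S$ with zero diagonal and off-diagonal entries $\pm1$ such that $SS^{\top}=(n-1)I$. $I$ denotes the identity matrix. *)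

theory Defs
  imports
    Complex_Main
    "HOL-Computational_Algebra.Fundamental_Theorem_Algebra"
    "Jordan_Normal_Form.Char_Poly"
    "Graph_Theory.Digraph"
begin

text \<open>
  Graphs are those of the locale \<^locale>\<open>graph\<close>: finite, loop-free symmetric digraphs without
  multiple arcs, an undirected edge being a pair of opposite arcs, so that
  \<open>u \<rightarrow>\<^bsub>G\<^esub> v\<close> is adjacency of \<open>u\<close> and \<open>v\<close>.  The list \<open>vs\<close> is the enumeration
  \<open>v\<^sub>1, \<dots>, v\<^sub>n\<close> of the vertices that fixes the order of rows and columns.
\<close>

definition seidel_matrix :: "('a, 'b) pre_digraph \<Rightarrow> 'a list \<Rightarrow> real mat" where
  "seidel_matrix G vs = mat (length vs) (length vs)
     (\<lambda>(i, j). if i = j then 0 else if vs ! i \<rightarrow>\<^bsub>G\<^esub> vs ! j then - 1 else 1)"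

text \<open>
  The eigenvalues with algebraic multiplicity.  They are taken in the complex numbers, so that a real
  \<open>n \<times> n\<close> matrix has exactly \<open>n\<close> of them without appeal to the spectral theorem.
\<close>

definition eigenvalues_mset :: "real mat \<Rightarrow> complex multiset" where
  "eigenvalues_mset A = proots (char_poly (map_mat complex_of_real A))"

lemma size_eigenvalues_mset:
  assumes "A \<in> carrier_mat n n"
  shows "size (eigenvalues_mset A) = n"
proof -
  have "map_mat complex_of_real A \<in> carrier_mat n n"
    using assms by simp
  from degree_monic_char_poly[OF this] show ?thesis
    by (simp add: eigenvalues_mset_def size_proots_complex)
qed

definition p_energy :: "real \<Rightarrow> real mat \<Rightarrow> real" where
  "p_energy p A = (\<Sum>\<mu>\<in>#eigenvalues_mset A. cmod \<mu> powr p)"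

definition conference_matrix :: "nat \<Rightarrow> real mat \<Rightarrow> bool" where
  "conference_matrix n S \<longleftrightarrow>
     S \<in> carrier_mat n n \<and>
     (\<forall>i<n. S $$ (i, i) = 0) \<and>
     (\<forall>i<n. \<forall>j<n. i \<noteq> j \<longrightarrow> S $$ (i, j) \<in> {- 1, 1}) \<and>
     S * transpose_mat S = (real n - 1) \<cdot>\<^sub>m 1\<^sub>m n"

definition symmetric_conference_matrix :: "nat \<Rightarrow> real mat \<Rightarrow> bool" where
  "symmetric_conference_matrix n S \<longleftrightarrow> conference_matrix n S \<and> transpose_mat S = S"

end

theory Submission
  imports Defs "Jordan_Normal_Form.Schur_Decomposition"
begin

text \<open>
  Write \<open>c = n - 1\<close> and let \<open>\<mu>\<close> range over the eigenvalues of the Seidel matrix \<open>S\<close>. Every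
  off-diagonal entry of \<open>S\<close> is \<open>\<plusminus>1\<close>, so the trace of \<open>S\<^sup>2\<close> is \<open>n (n - 1)\<close>; hence the numbers
  \<open>\<bar>\<mu>\<bar>\<^sup>2\<close> have mean \<open>c\<close> whatever the graph is. The energy is the sum of \<open>(\<bar>\<mu>\<bar>\<^sup>2) powr (p / 2)\<close>, and
  since \<open>p / 2 > 1\<close> the strict convexity of this power bounds the sum below by its value when every
  \<open>\<bar>\<mu>\<bar>\<^sup>2\<close> equals the mean, with equality only in that case (\<open>power_mean_mset\<close>).

  It remains to see that \<open>\<bar>\<mu>\<bar>\<^sup>2 = c\<close> for all \<open>\<mu>\<close> exactly if \<open>S\<^sup>2 = c I\<close>. Diagonalising \<open>S\<close> would show
  this, but traces suffice: the squared Frobenius norm of \<open>S\<^sup>2 - c I\<close> is the trace of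
  \<open>S\<^sup>4 - 2 c S\<^sup>2 + c\<^sup>2 I\<close>, which is the sum of \<open>(\<bar>\<mu>\<bar>\<^sup>2 - c)\<^sup>2\<close>
  (\<open>frobenius_distance_square_from_scalar\<close>). One side vanishes exactly if \<open>S\<^sup>2 = c I\<close>, the other
  exactly if all \<open>\<bar>\<mu>\<bar>\<^sup>2\<close> are \<open>c\<close>. The traces of powers are power sums of the eigenvalues by Schur
  triangularisation, and \<open>\<mu>\<^sup>2 = \<bar>\<mu>\<bar>\<^sup>2\<close> because a real symmetric matrix has real eigenvalues.
  Finally, as \<open>S\<close> is symmetric with the right entries, \<open>S\<^sup>2 = c I\<close> is the one remaining condition
  for a symmetric conference matrix.
\<close>

section \<open>Traces of powers\<close>

definition mat_trace :: "'a::comm_monoid_add mat \<Rightarrow> 'a" where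
  "mat_trace A = (\<Sum>i<dim_row A. A $$ (i, i))"

lemma mat_trace_mult_commute:
  fixes A B :: "'a::comm_semiring_0 mat"
  assumes "A \<in> carrier_mat n m" "B \<in> carrier_mat m n"
  shows "mat_trace (A * B) = mat_trace (B * A)"
proof -
  have "mat_trace (A * B) = (\<Sum>i<n. \<Sum>j<m. A $$ (i, j) * B $$ (j, i))"
    using assms by (simp add: mat_trace_def scalar_prod_def atLeast0LessThan)
  also have "\<dots> = (\<Sum>j<m. \<Sum>i<n. B $$ (j, i) * A $$ (i, j))"
    by (subst sum.swap) (simp add: mult.commute)
  also have "\<dots> = mat_trace (B * A)"
    using assms by (simp add: mat_trace_def scalar_prod_def atLeast0LessThan)
  finally show ?thesis .
qed

lemma mat_trace_similar:
  fixes A B :: "'a::comm_ring_1 mat"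
  assumes "A \<in> carrier_mat n n" "similar_mat_wit A B P Q"
  shows "mat_trace A = mat_trace B"
proof -
  note D = similar_mat_witD2[OF assms]
  have "mat_trace A = mat_trace (P * (B * Q))"
    using D by (simp add: assoc_mult_mat[of P n n B n Q n])
  also have "\<dots> = mat_trace (B * Q * P)"
    using D by (intro mat_trace_mult_commute[of _ n n]) auto
  also have "B * Q * P = B"
    using D by (simp add: assoc_mult_mat[of B n n Q n P n])
  finally show ?thesis .
qed

lemma upper_triangular_pow:
  fixes U :: "'a::semiring_1 mat"
  assumes U: "U \<in> carrier_mat n n" and ut: "upper_triangular U"
  shows "upper_triangular (U ^\<^sub>m k)" and "i < n \<Longrightarrow> (U ^\<^sub>m k) $$ (i, i) = U $$ (i, i) ^ k"
proof -
  have "(\<forall>i<n. \<forall>j<i. (U ^\<^sub>m k) $$ (i, j) = 0) \<and> (\<forall>i<n. (U ^\<^sub>m k) $$ (i, i) = U $$ (i, i) ^ k)"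
  proof (induction k)
    case 0
    then show ?case using U by auto
  next
    case (Suc k)
    have entry: "(U ^\<^sub>m Suc k) $$ (i, j) = (\<Sum>l<n. (U ^\<^sub>m k) $$ (i, l) * U $$ (l, j))"
      if "i < n" "j < n" for i j
      using U that by (simp add: scalar_prod_def atLeast0LessThan)
    \<comment> \<open>Only \<open>i \<le> l \<le> j\<close> contributes: no \<open>l\<close> below the diagonal, only \<open>l = i\<close> on it.\<close>
    have zero: "(U ^\<^sub>m k) $$ (i, l) * U $$ (l, j) = 0"
      if "i < n" "l < n" "l < i \<or> j < l" for i j l
      using that Suc U upper_triangularD[OF ut, of j l] by auto
    have "(U ^\<^sub>m Suc k) $$ (i, j) = 0" if "i < n" "j < i" for i j
      unfolding entry[OF that(1) less_trans[OF that(2,1)]]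
    proof (intro sum.neutral ballI)
      fix l
      assume "l \<in> {..<n}"
      moreover have "l < i \<or> j < l"
        using that by linarith
      ultimately show "(U ^\<^sub>m k) $$ (i, l) * U $$ (l, j) = 0"
        using zero that by blast
    qed
    moreover have "(U ^\<^sub>m Suc k) $$ (i, i) = U $$ (i, i) ^ Suc k" if i: "i < n" for i
    proof -
      have "(\<Sum>l<n. (U ^\<^sub>m k) $$ (i, l) * U $$ (l, i)) = (\<Sum>l\<in>{i}. (U ^\<^sub>m k) $$ (i, l) * U $$ (l, i))"
        by (rule sum.mono_neutral_right) (use i zero[OF i, of _ i] in \<open>auto simp: nat_neq_iff\<close>)
      then show ?thesis
        unfolding entry[OF i i] using Suc i by (simp add: power_commutes)
    qed
    ultimately show ?case by blast
  qed
  then show "upper_triangular (U ^\<^sub>m k)" and "i < n \<Longrightarrow> (U ^\<^sub>m k) $$ (i, i) = U $$ (i, i) ^ k"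
    using U by (auto intro!: upper_triangularI)
qed

text \<open>
  Over the complex numbers the matrix is similar to a triangular one that has the eigenvalues on its
  diagonal. Similarity carries over to powers and preserves the trace, and the diagonal of a power of
  a triangular matrix holds the powers of the diagonal entries.
\<close>

lemma mat_trace_pow_eq_sum_eigenvalues:
  assumes A: "A \<in> carrier_mat n n"
  shows "complex_of_real (mat_trace (A ^\<^sub>m k)) = (\<Sum>\<mu>\<in>#eigenvalues_mset A. \<mu> ^ k)"
proof -
  define C where "C = map_mat complex_of_real A"
  have C: "C \<in> carrier_mat n n"
    using A by (simp add: C_def)
  from char_poly_factorized[OF C] obtain es where
    es: "char_poly C = (\<Prod>e\<leftarrow>es. [:- e, 1:])" by blast
  obtain U P Q where "schur_decomposition C es = (U, P, Q)"
    by (cases "schur_decomposition C es") auto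
  from schur_decomposition[OF C es this] have wit: "similar_mat_wit C U P Q"
    and ut: "upper_triangular U" and diag: "diag_mat U = es" by auto
  have U: "U \<in> carrier_mat n n"
    using similar_mat_witD2[OF C wit] by simp
  have "eigenvalues_mset A = mset es"
    unfolding eigenvalues_mset_def C_def[symmetric] es
  proof (induction es)
    case (Cons e es)
    have "(\<Prod>e\<leftarrow>es. [:- e, 1:]) \<noteq> 0"
      by (auto simp: prod_list_zero_iff)
    then have "proots ([:- e, 1:] * (\<Prod>e\<leftarrow>es. [:- e, 1:])) = {#e#} + mset es"
      by (subst proots_mult) (auto simp: Cons)
    then show ?case
      by (simp del: mult_pCons_left)
  qed simp
  then have "(\<Sum>\<mu>\<in>#eigenvalues_mset A. \<mu> ^ k) = (\<Sum>\<mu>\<leftarrow>es. \<mu> ^ k)"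
    by (simp add: sum_mset_sum_list flip: mset_map)
  also have "\<dots> = (\<Sum>i<n. U $$ (i, i) ^ k)"
    using U unfolding diag[symmetric] diag_mat_def
    by (simp add: interv_sum_list_conv_sum_set_nat comp_def atLeast0LessThan)
  also have "\<dots> = mat_trace (U ^\<^sub>m k)"
    using U upper_triangular_pow(2)[OF U ut] by (simp add: mat_trace_def)
  also have "\<dots> = mat_trace (C ^\<^sub>m k)"
    using mat_trace_similar[OF pow_carrier_mat[OF C] similar_mat_wit_pow[OF wit]] by simp
  also have "\<dots> = complex_of_real (mat_trace (A ^\<^sub>m k))"
    using A pow_carrier_mat[OF A, of k]
    by (simp add: C_def mat_trace_def flip: of_real_hom.mat_hom_pow[OF A])
  finally show ?thesis by simp
qed

section \<open>Eigenvalues of real symmetric matrices\<close>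

text \<open>
  For an eigenvector \<open>v\<close>, moving the matrix to the other factor of the Hermitian product \<open>v \<bullet>c v\<close>
  replaces \<open>\<mu>\<close> by its conjugate, and \<open>v \<bullet>c v\<close> is not zero.
\<close>

lemma eigenvalues_mset_symmetric_real:
  assumes A: "A \<in> carrier_mat n n" and sym: "transpose_mat A = A"
    and "\<mu> \<in># eigenvalues_mset A"
  shows "\<mu> \<in> \<real>"
proof -
  define C where "C = map_mat complex_of_real A"
  have C: "C \<in> carrier_mat n n"
    using A by (simp add: C_def)
  have Csym: "transpose_mat C = C"
    using sym A by (metis C_def map_mat_transpose)
  have "char_poly C \<noteq> 0"
    using degree_monic_char_poly[OF C] by auto
  then have "eigenvalue C \<mu>"
    using assms(3) C by (simp add: eigenvalues_mset_def C_def eigenvalue_root_char_poly)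
  then obtain v where v: "v \<in> carrier_vec n" "v \<noteq> 0\<^sub>v n" and ev: "C *\<^sub>v v = \<mu> \<cdot>\<^sub>v v"
    using C by (auto simp: eigenvalue_def eigenvector_def)
  have conj: "C *\<^sub>v conjugate v = conjugate (C *\<^sub>v v)"
    using v A by (intro eq_vecI) (auto simp: C_def scalar_prod_def)
  have "\<mu> * (v \<bullet>c v) = (C *\<^sub>v v) \<bullet>c v"
    using v by (simp add: ev)
  also have "\<dots> = v \<bullet> (C *\<^sub>v conjugate v)"
    using transpose_vec_mult_scalar[OF C, of "conjugate v" v] v Csym by simp
  also have "\<dots> = cnj \<mu> * (v \<bullet>c v)"
    using v by (simp add: conj ev conjugate_smult_vec)
  finally have "\<mu> = cnj \<mu>"
    using v by (simp add: conjugate_square_eq_0_vec)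
  then show ?thesis
    by (metis Reals_cnj_iff)
qed

text \<open>
  Real eigenvalues satisfy \<open>\<mu>\<^sup>2 = \<bar>\<mu>\<bar>\<^sup>2\<close>, which turns even power sums into sums of the nonnegative
  reals that the energy is made of.
\<close>

lemma mat_trace_even_pow_eq_sum_eigenvalues:
  assumes A: "A \<in> carrier_mat n n" and sym: "transpose_mat A = A"
  shows "mat_trace (A ^\<^sub>m (2 * k)) = (\<Sum>\<mu>\<in>#eigenvalues_mset A. ((cmod \<mu>)\<^sup>2) ^ k)"
proof -
  have "\<mu> ^ (2 * k) = complex_of_real (((cmod \<mu>)\<^sup>2) ^ k)" if "\<mu> \<in># eigenvalues_mset A" for \<mu>
  proof -
    have "\<mu> \<in> \<real>"
      by (rule eigenvalues_mset_symmetric_real[OF A sym that])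
    then obtain r where "\<mu> = complex_of_real r"
      by (auto elim: Reals_cases)
    then show ?thesis
      by (simp add: power_mult)
  qed
  then have "image_mset (\<lambda>\<mu>. \<mu> ^ (2 * k)) (eigenvalues_mset A)
      = image_mset (\<lambda>\<mu>. complex_of_real (((cmod \<mu>)\<^sup>2) ^ k)) (eigenvalues_mset A)"
    by (intro image_mset_cong) auto
  then have "complex_of_real (mat_trace (A ^\<^sub>m (2 * k)))
      = (\<Sum>\<mu>\<in>#eigenvalues_mset A. complex_of_real (((cmod \<mu>)\<^sup>2) ^ k))"
    by (simp only: mat_trace_pow_eq_sum_eigenvalues[OF A])
  also have "\<dots> = complex_of_real (\<Sum>\<mu>\<in>#eigenvalues_mset A. ((cmod \<mu>)\<^sup>2) ^ k)"
  proof -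
    have "(\<Sum>x\<in>#M. complex_of_real (f x)) = complex_of_real (\<Sum>x\<in>#M. f x)"
      for M :: "complex multiset" and f
      by (induction M) simp_all
    then show ?thesis .
  qed
  finally show ?thesis
    by (simp only: of_real_eq_iff)
qed

lemma mat_trace_square_symmetric:
  fixes B :: "'a::comm_semiring_1 mat"
  assumes B: "B \<in> carrier_mat n n" and sym: "transpose_mat B = B"
  shows "mat_trace (B ^\<^sub>m 2) = (\<Sum>i<n. \<Sum>j<n. (B $$ (i, j))\<^sup>2)"
proof -
  have flip: "B $$ (j, i) = B $$ (i, j)" if "i < n" "j < n" for i j
    using B that index_transpose_mat(1)[of j B i] sym by auto
  have "mat_trace (B ^\<^sub>m 2) = (\<Sum>i<n. \<Sum>j<n. B $$ (i, j) * B $$ (j, i))"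
    using B by (simp add: mat_trace_def numeral_2_eq_2 scalar_prod_def atLeast0LessThan)
  also have "\<dots> = (\<Sum>i<n. \<Sum>j<n. (B $$ (i, j))\<^sup>2)"
    by (intro sum.cong refl) (simp add: flip power2_eq_square)
  finally show ?thesis .
qed

text \<open>
  Expanding the square expresses both sides through the same three quantities: the traces of \<open>A\<^sup>4\<close>
  and \<open>A\<^sup>2\<close>, and the size \<open>n\<close>. The trace of \<open>A\<^sup>4\<close> enters as the sum of the squared entries of the
  symmetric matrix \<open>A\<^sup>2\<close>.
\<close>

lemma frobenius_distance_square_from_scalar:
  assumes A: "A \<in> carrier_mat n n" and sym: "transpose_mat A = A"
  shows "(\<Sum>i<n. \<Sum>j<n. ((A ^\<^sub>m 2) $$ (i, j) - (c \<cdot>\<^sub>m 1\<^sub>m n) $$ (i, j))\<^sup>2)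
    = (\<Sum>\<mu>\<in>#eigenvalues_mset A. ((cmod \<mu>)\<^sup>2 - c)\<^sup>2)"
proof -
  define B where "B = A ^\<^sub>m 2"
  have AA: "B = A * A"
    using A by (simp add: B_def numeral_2_eq_2)
  have B: "B \<in> carrier_mat n n"
    using A by (simp add: B_def)
  have Bsym: "transpose_mat B = B"
    using transpose_mult[OF A A] sym by (simp add: AA)
  have BB: "B ^\<^sub>m 2 = A ^\<^sub>m (2 * 2)"
    using A B by (simp add: AA numeral_eq_Suc assoc_mult_mat[of _ n n _ n _ n])
  have "(\<Sum>i<n. \<Sum>j<n. (B $$ (i, j) - (c \<cdot>\<^sub>m 1\<^sub>m n) $$ (i, j))\<^sup>2)
      = (\<Sum>i<n. \<Sum>j<n. (B $$ (i, j))\<^sup>2 + (if j = i then c\<^sup>2 - 2 * c * B $$ (i, i) else 0))"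
    \<comment> \<open>The conditional is written so that the inner sum over \<open>j\<close> collapses to its diagonal term.\<close>
    by (intro sum.cong refl) (auto simp: power2_eq_square algebra_simps)
  also have "\<dots> = mat_trace (B ^\<^sub>m 2) - 2 * c * mat_trace B + real n * c\<^sup>2"
    using B unfolding mat_trace_square_symmetric[OF B Bsym]
    by (simp add: sum.distrib sum_subtractf mat_trace_def sum_distrib_left)
  also have "\<dots> = (\<Sum>\<mu>\<in>#eigenvalues_mset A. ((cmod \<mu>)\<^sup>2) ^ 2)
      - 2 * c * (\<Sum>\<mu>\<in>#eigenvalues_mset A. ((cmod \<mu>)\<^sup>2) ^ 1) + real (size (eigenvalues_mset A)) * c\<^sup>2"
    using mat_trace_even_pow_eq_sum_eigenvalues[OF A sym, of 1]
      mat_trace_even_pow_eq_sum_eigenvalues[OF A sym, of 2]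
    unfolding BB size_eigenvalues_mset[OF A] by (simp add: B_def)
  also have "\<dots> = (\<Sum>\<mu>\<in>#eigenvalues_mset A. ((cmod \<mu>)\<^sup>2 - c)\<^sup>2)"
  proof -
    have "(\<Sum>x\<in>#M. (f x)\<^sup>2) - 2 * c * (\<Sum>x\<in>#M. f x ^ 1) + real (size M) * c\<^sup>2
        = (\<Sum>x\<in>#M. (f x - c)\<^sup>2)" for M :: "complex multiset" and f
      by (induction M) (simp_all add: power2_eq_square algebra_simps)
    then show ?thesis .
  qed
  finally show ?thesis
    by (simp add: B_def)
qed

lemma sum_mset_eq_0_iff_nonneg:
  fixes f :: "'a \<Rightarrow> 'b::ordered_comm_monoid_add"
  assumes "\<And>x. x \<in># M \<Longrightarrow> 0 \<le> f x"
  shows "(\<Sum>x\<in>#M. f x) = 0 \<longleftrightarrow> (\<forall>x\<in>#M. f x = 0)"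
  using assms
proof (induction M)
  case (add x M)
  have "0 \<le> (\<Sum>x\<in>#M. f x)"
    using add.prems sum_mset_mono[of M "\<lambda>_. 0" f] by simp
  then show ?case
    using add by (simp add: add_nonneg_eq_0_iff)
qed simp

text \<open>
  Both sides say that one and the same sum of squares vanishes, so neither direction needs a basis of
  eigenvectors.
\<close>

lemma square_eq_scalar_iff_eigenvalues:
  assumes A: "A \<in> carrier_mat n n" and sym: "transpose_mat A = A"
  shows "A ^\<^sub>m 2 = c \<cdot>\<^sub>m 1\<^sub>m n \<longleftrightarrow> (\<forall>\<mu>\<in>#eigenvalues_mset A. (cmod \<mu>)\<^sup>2 = c)"
proof -
  have "A ^\<^sub>m 2 = c \<cdot>\<^sub>m 1\<^sub>m n \<longleftrightarrow> (\<forall>i<n. \<forall>j<n. (A ^\<^sub>m 2) $$ (i, j) = (c \<cdot>\<^sub>m 1\<^sub>m n) $$ (i, j))"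
    using A by (auto simp: mat_eq_iff)
  also have "\<dots> \<longleftrightarrow> (\<Sum>i<n. \<Sum>j<n. ((A ^\<^sub>m 2) $$ (i, j) - (c \<cdot>\<^sub>m 1\<^sub>m n) $$ (i, j))\<^sup>2) = 0"
    by (simp add: sum_nonneg_eq_0_iff sum_nonneg Ball_def del: index_smult_mat index_one_mat)
  also have "\<dots> \<longleftrightarrow> (\<forall>\<mu>\<in>#eigenvalues_mset A. (cmod \<mu>)\<^sup>2 = c)"
    unfolding frobenius_distance_square_from_scalar[OF A sym]
    by (subst sum_mset_eq_0_iff_nonneg) auto
  finally show ?thesis .
qed

section \<open>The power mean inequality\<close>

text \<open>
  The function \<open>x powr q\<close> is strictly convex for \<open>q > 1\<close>. Away from \<open>0\<close> this is the mean value theorem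
  with an increasing derivative; at \<open>x = 0\<close> the
  tangent at \<open>c\<close> has the negative value \<open>(1 - q) * c powr q\<close>.
\<close>

lemma powr_above_tangent:
  fixes x c q :: real
  assumes "c > 0" "x \<ge> 0" "q > 1" "x \<noteq> c"
  shows "c powr q + q * c powr (q - 1) * (x - c) < x powr q"
proof -
  have deriv: "((\<lambda>y. y powr q) has_real_derivative q * y powr (q - 1)) (at y)" if "y > 0" for y
    using that by (auto intro!: derivative_eq_intros)
  consider "x = 0" | "0 < x" "x < c" | "c < x"
    using assms by linarith
  then show ?thesis
  proof cases
    case 1
    have "c powr (q - 1) * c = c powr q"
      using assms powr_add[of c "q - 1" 1] by simp
    then have "c powr q + q * c powr (q - 1) * (0 - c) = (1 - q) * c powr q"
      by (simp add: algebra_simps)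
    also have "\<dots> < 0"
      using assms by (simp add: mult_neg_pos)
    finally show ?thesis
      using 1 assms by simp
  next
    case 2
    obtain z where z: "x < z" "z < c" "c powr q - x powr q = (c - x) * (q * z powr (q - 1))"
      using MVT2[of x c "\<lambda>y. y powr q" "\<lambda>y. q * y powr (q - 1)"] deriv 2 by force
    have "z powr (q - 1) < c powr (q - 1)"
      using z 2 assms by (intro powr_less_mono2) auto
    then have "(c - x) * (q * z powr (q - 1)) < (c - x) * (q * c powr (q - 1))"
      using 2 assms by (intro mult_strict_left_mono) auto
    then show ?thesis
      using z(3) by (simp add: algebra_simps)
  next
    case 3
    obtain z where z: "c < z" "z < x" "x powr q - c powr q = (x - c) * (q * z powr (q - 1))"
      using MVT2[of c x "\<lambda>y. y powr q" "\<lambda>y. q * y powr (q - 1)"] deriv 3 assms by force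
    have "c powr (q - 1) < z powr (q - 1)"
      using z assms by (intro powr_less_mono2) auto
    then have "(x - c) * (q * c powr (q - 1)) < (x - c) * (q * z powr (q - 1))"
      using 3 assms by (intro mult_strict_left_mono) auto
    then show ?thesis
      using z(3) by (simp add: algebra_simps)
  qed
qed

text \<open>
  Summing the tangent inequality at the mean gives Jensen's inequality together with its equality
  case: the excess of the sum of powers over the bound is a sum of gaps between the power and its tangent, each of
  which vanishes only at the point of contact \<open>c\<close>.
\<close>

lemma power_mean_mset:
  fixes f :: "'a \<Rightarrow> real" and c q :: real
  assumes "c > 0" "q > 1" "\<And>x. x \<in># M \<Longrightarrow> f x \<ge> 0"
    and mean: "(\<Sum>x\<in>#M. f x) = real (size M) * c"
  shows "real (size M) * c powr q \<le> (\<Sum>x\<in>#M. f x powr q)"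
    and "(\<Sum>x\<in>#M. f x powr q) = real (size M) * c powr q \<longleftrightarrow> (\<forall>x\<in>#M. f x = c)"
proof -
  define gap where "gap x = f x powr q - (c powr q + q * c powr (q - 1) * (f x - c))" for x
  have gap_pos: "gap x \<ge> 0 \<and> (gap x = 0 \<longleftrightarrow> f x = c)" if "x \<in># M" for x
    using powr_above_tangent[of c "f x" q] assms that by (cases "f x = c") (auto simp: gap_def)
  \<comment> \<open>The linear terms of the tangents cancel because \<open>c\<close> is the mean.\<close>
  have "(\<Sum>x\<in>#M. gap x) = (\<Sum>x\<in>#M. f x powr q) - real (size M) * c powr q
      - q * c powr (q - 1) * ((\<Sum>x\<in>#M. f x) - real (size M) * c)"
    unfolding gap_def by (induction M) (simp_all add: algebra_simps)
  then have total: "(\<Sum>x\<in>#M. gap x) = (\<Sum>x\<in>#M. f x powr q) - real (size M) * c powr q"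
    using mean by simp
  have "0 \<le> (\<Sum>x\<in>#M. gap x)"
    using gap_pos sum_mset_mono[of M "\<lambda>_. 0" gap] by simp
  then show "real (size M) * c powr q \<le> (\<Sum>x\<in>#M. f x powr q)"
    using total by simp
  have "(\<Sum>x\<in>#M. gap x) = 0 \<longleftrightarrow> (\<forall>x\<in>#M. f x = c)"
    using sum_mset_eq_0_iff_nonneg[of M gap] gap_pos by blast
  then show "(\<Sum>x\<in>#M. f x powr q) = real (size M) * c powr q \<longleftrightarrow> (\<forall>x\<in>#M. f x = c)"
    using total by simp
qed

section \<open>Seidel matrices\<close>

lemma seidel_matrix_carrier: "seidel_matrix G vs \<in> carrier_mat (length vs) (length vs)"
  by (simp add: seidel_matrix_def)

lemma seidel_matrix_symmetric:
  assumes "symmetric G"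
  shows "transpose_mat (seidel_matrix G vs) = seidel_matrix G vs"
  using arcs_ends_symmetric[OF assms]
  by (intro eq_matI) (auto simp: seidel_matrix_def)

text \<open>
  This is where the entries \<open>\<plusminus>1\<close> matter: their squares do not depend on the graph.
\<close>

lemma mat_trace_seidel_square:
  assumes "symmetric G"
  shows "mat_trace (seidel_matrix G vs ^\<^sub>m 2) = real (length vs) * (real (length vs) - 1)"
proof -
  let ?n = "length vs"
  have "mat_trace (seidel_matrix G vs ^\<^sub>m 2)
      = (\<Sum>i<?n. \<Sum>j<?n. (seidel_matrix G vs $$ (i, j))\<^sup>2)"
    by (rule mat_trace_square_symmetric[OF seidel_matrix_carrier seidel_matrix_symmetric[OF assms]])
  also have "\<dots> = (\<Sum>i<?n. \<Sum>j<?n. 1 - (if j = i then 1 else 0))"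
    by (intro sum.cong refl) (auto simp: seidel_matrix_def)
  also have "\<dots> = real ?n * (real ?n - 1)"
    by (simp add: sum_subtractf)
  finally show ?thesis .
qed

lemma symmetric_conference_matrix_seidel_iff:
  assumes "symmetric G"
  shows "symmetric_conference_matrix (length vs) (seidel_matrix G vs) \<longleftrightarrow>
    seidel_matrix G vs ^\<^sub>m 2 = (real (length vs) - 1) \<cdot>\<^sub>m 1\<^sub>m (length vs)"
proof -
  have "\<forall>i<length vs. seidel_matrix G vs $$ (i, i) = 0"
    and "\<forall>i<length vs. \<forall>j<length vs. i \<noteq> j \<longrightarrow> seidel_matrix G vs $$ (i, j) \<in> {- 1, 1}"
    by (simp_all add: seidel_matrix_def)
  then show ?thesis
    using seidel_matrix_carrier[of G vs] seidel_matrix_symmetric[OF assms, of vs]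
    by (simp add: symmetric_conference_matrix_def conference_matrix_def numeral_2_eq_2)
qed

theorem theorem2p8:
  fixes G :: "('a, 'b) pre_digraph" and vs :: "'a list" and n :: nat and p :: real
  assumes "graph G" and "arcs G \<noteq> {}"
    and "card (verts G) = n" and "n \<ge> 2"
    and "distinct vs" and "set vs = verts G"
    and "p > 2"
  shows "p_energy p (seidel_matrix G vs) \<ge> real n * (real n - 1) powr (p / 2) \<and>
    (p_energy p (seidel_matrix G vs) = real n * (real n - 1) powr (p / 2) \<longleftrightarrow>
      seidel_matrix G vs ^\<^sub>m 2 = (real n - 1) \<cdot>\<^sub>m 1\<^sub>m n) \<and>
    (seidel_matrix G vs ^\<^sub>m 2 = (real n - 1) \<cdot>\<^sub>m 1\<^sub>m n \<longleftrightarrow>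
      symmetric_conference_matrix n (seidel_matrix G vs))"
proof -
  let ?S = "seidel_matrix G vs"
  interpret graph G by fact
  have symG: "symmetric G" ..
  have n: "length vs = n"
    using assms distinct_card by metis
  have S: "?S \<in> carrier_mat n n"
    using seidel_matrix_carrier[of G vs] n by simp
  note symS = seidel_matrix_symmetric[OF symG, of vs]
  have size: "size (eigenvalues_mset ?S) = n"
    by (rule size_eigenvalues_mset[OF S])
  have mean: "(\<Sum>\<mu>\<in>#eigenvalues_mset ?S. (cmod \<mu>)\<^sup>2)
      = real (size (eigenvalues_mset ?S)) * (real n - 1)"
    using mat_trace_even_pow_eq_sum_eigenvalues[OF S symS, of 1]
      mat_trace_seidel_square[OF symG, of vs] n size by simp
  have "cmod \<mu> powr p = ((cmod \<mu>)\<^sup>2) powr (p / 2)" for \<mu>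
    using powr_powr[of "cmod \<mu>" 2 "p / 2"] by simp
  then have energy: "p_energy p ?S = (\<Sum>\<mu>\<in>#eigenvalues_mset ?S. ((cmod \<mu>)\<^sup>2) powr (p / 2))"
    by (simp add: p_energy_def)
  note jensen = power_mean_mset[OF _ _ _ mean, of "p / 2", folded energy, unfolded size]
  show ?thesis
    using jensen assms square_eq_scalar_iff_eigenvalues[OF S symS, of "real n - 1"]
      symmetric_conference_matrix_seidel_iff[OF symG, of vs] n
    by auto
qed

end
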